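(* Let $m,n\ge 4$. Let $K$ and $L$ be regular languages over a finite alphabet $\Sigma$ that are both bifix-free (respectively, both factor-free), with $\kappa(K)=m$ and $\kappa(L)=n$. Then 1. $\kappa(K\cap L)\le mn-3(m+n-4)$; 2. $\kappa(K\setminus L)\le mn-(2m+3n-9)$; 3. $\kappa(K\cup L)\le mn-(m+n)$ and $\kappa(K\oplus L)\le mn-(m+n)$. Moreover, all these bounds are tight if $|\Sigma|\ge 3$, both in the class of bifix-free languages and in the class of factor-free languages: for each of the two classes, for each of the four operations, for all $m,n\ge 4$, and for every finite alphabet $\Sigma$ with $|\Sigma|\ge 3$, there exist languages $K$ and $L$ over $\Sigma$ in that class with $\kappa(K)=m$ and $\kappa(L)=n$ for which the corresponding inequality is an equality.
   Context: For a language $L\subseteq\Sigma^*$ over a finite non-empty alphabet $\Sigma$ and a word $w\in\Sigma^*$, the (left) quotient of $L$ by $w$ is $L_w=\{x\in\Sigma^*\mid wx\in L\}$. The quotient complexity $\kappa(L)$ of a regular language $L$ is the number of distinct quotients $L_w$, $w\in\Sigma^*$; it equals the number of states of the minimal complete deterministic finite automaton accepting $L$ over $\Sigma$. $K\oplus L$ denotes symmetric difference. If $w=uxv$ with $u,x,v\in\Sigma^*$, then $u$ is a prefix, $x$ a factor, and $v$ a suffix of $w$. A language $L$ is prefix-free (respectively suffix-free, factor-free) if, whenever $u,v\in L$ and $u$ is a prefix (respectively suffix, factor) of $v$, then $u=v$. A language is bifix-free if it is both prefix-free and suffix-free. Every factor-free language is bifix-free. *)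

theory Defs
  imports Main "HOL-Library.Sublist"
begin

text \<open>
  An alphabet is a finite non-empty set \<open>\<Sigma>\<close> of letters, and \<open>lists \<Sigma>\<close> is the set of
  all words over it.
\<close>

definition left_quotient :: "'a set \<Rightarrow> 'a list \<Rightarrow> 'a list set \<Rightarrow> 'a list set" where
  "left_quotient \<Sigma> w L = {x \<in> lists \<Sigma>. w @ x \<in> L}"

text \<open>
  The cardinality below is a true count only if the set of quotients is finite, which is
  the case for every regular language; \<^const>\<open>card\<close> of an infinite set is 0.
\<close>

definition quotient_complexity :: "'a set \<Rightarrow> 'a list set \<Rightarrow> nat" where
  "quotient_complexity \<Sigma> L = card ((\<lambda>w. left_quotient \<Sigma> w L) ` lists \<Sigma>)"

text \<open>
  A language is regular if it is accepted by a complete deterministic finite automaton.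
  The states may be taken to be natural numbers, since the states of any finite automaton
  can be renamed; \<open>\<delta>\<close> matters only on \<open>Q\<close> and \<open>\<Sigma>\<close>.
\<close>

definition regular_language :: "'a set \<Rightarrow> 'a list set \<Rightarrow> bool" where
  "regular_language \<Sigma> L \<longleftrightarrow>
    (\<exists>(Q :: nat set) q0 F (\<delta> :: nat \<Rightarrow> 'a \<Rightarrow> nat).
      finite Q \<and> q0 \<in> Q \<and> F \<subseteq> Q \<and> (\<forall>q\<in>Q. \<forall>a\<in>\<Sigma>. \<delta> q a \<in> Q) \<and>
      L = {w \<in> lists \<Sigma>. foldl \<delta> q0 w \<in> F})"

definition prefix_free :: "'a list set \<Rightarrow> bool" where
  "prefix_free L \<longleftrightarrow> (\<forall>u\<in>L. \<forall>v\<in>L. prefix u v \<longrightarrow> u = v)"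

definition suffix_free :: "'a list set \<Rightarrow> bool" where
  "suffix_free L \<longleftrightarrow> (\<forall>u\<in>L. \<forall>v\<in>L. suffix u v \<longrightarrow> u = v)"

text \<open>The library's \<^const>\<open>sublist\<close> is the contiguous one, i.e. the factor relation.\<close>

definition factor_free :: "'a list set \<Rightarrow> bool" where
  "factor_free L \<longleftrightarrow> (\<forall>u\<in>L. \<forall>v\<in>L. sublist u v \<longrightarrow> u = v)"

definition bifix_free :: "'a list set \<Rightarrow> bool" where
  "bifix_free L \<longleftrightarrow> prefix_free L \<and> suffix_free L"

end

theory Submission
  imports Defs
begin

text \<open>
  A bifix-free language with at least four quotients has the quotients \<open>L\<close>, \<open>{}\<close> and \<open>{[]}\<close>; it
  never returns to \<open>L\<close> (suffix-freeness), and \<open>{[]}\<close> is its only quotient containing the empty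
  word (prefix-freeness). A quotient of a boolean combination is the combination of two quotients,
  and the upper bounds count the combinations that remain distinct.

  For tightness, fix letters \<open>a\<close>, \<open>b\<close>, \<open>c\<close>; all other letters lead to the empty quotient, and below
  \<open>w\<close> ranges over the words in \<open>a\<close> and \<open>b\<close>. For intersection and difference, \<open>K\<close> and \<open>L\<close> consist of
  the words \<open>c w c\<close> where \<open>w\<close> has exactly \<open>m - 4\<close> letters \<open>a\<close>, respectively exactly \<open>n - 4\<close> letters
  \<open>b\<close>. For union and symmetric difference the closing \<open>c\<close> is replaced by \<open>a\<close> in \<open>K\<close> and by \<open>b\<close> in \<open>L\<close>,
  which makes the two languages disjoint and lets each of them be completed and abandoned while
  the other one is still being read.
\<close>

section \<open>Quotients and regular languages\<close>

abbreviation quotients :: "'a set \<Rightarrow> 'a list set \<Rightarrow> 'a list set set" where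
  "quotients \<Sigma> L \<equiv> (\<lambda>w. left_quotient \<Sigma> w L) ` lists \<Sigma>"

lemma left_quotient_Nil: "L \<subseteq> lists \<Sigma> \<Longrightarrow> left_quotient \<Sigma> [] L = L"
  by (auto simp: left_quotient_def)

lemma left_quotient_append:
  "v \<in> lists \<Sigma> \<Longrightarrow> left_quotient \<Sigma> (u @ v) L = left_quotient \<Sigma> v (left_quotient \<Sigma> u L)"
  by (auto simp: left_quotient_def)

lemma left_quotient_closed:
  assumes "L \<subseteq> lists \<Sigma>" and "L \<in> S"
    and step: "\<And>X x. X \<in> S \<Longrightarrow> x \<in> \<Sigma> \<Longrightarrow> left_quotient \<Sigma> [x] X \<in> S"
    and "w \<in> lists \<Sigma>"
  shows "left_quotient \<Sigma> w L \<in> S"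
  using assms(4)
proof (induction w rule: rev_induct)
  case Nil
  then show ?case using assms(1,2) by (simp add: left_quotient_Nil)
next
  case (snoc x w)
  then show ?case using step by (simp add: left_quotient_append)
qed

text \<open>One half of the Myhill-Nerode theorem: the quotients serve as states, numbered by an
  injection \<open>g\<close> because \<open>regular_language\<close> asks for natural
  numbers.\<close>

lemma regular_if_finite_quotients:
  assumes sub: "L \<subseteq> lists \<Sigma>" and fin: "finite (quotients \<Sigma> L)"
  shows "regular_language \<Sigma> L"
proof -
  obtain g :: "'a list set \<Rightarrow> nat" where g: "inj_on g (quotients \<Sigma> L)"
    using fin finite_imp_inj_to_nat_seg by blast
  define st where "st w = g (left_quotient \<Sigma> w L)" for w
  \<comment> \<open>\<open>inv_into\<close> recovers the quotient from its number; the next quotient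
    depends on nothing else.\<close>
  define \<delta> where "\<delta> q x = g (left_quotient \<Sigma> [x] (inv_into (quotients \<Sigma> L) g q))" for q x
  have step: "\<delta> (st w) x = st (w @ [x])" if "w \<in> lists \<Sigma>" "x \<in> \<Sigma>" for w x
    using that g by (simp add: \<delta>_def st_def left_quotient_append)
  have run: "foldl \<delta> (st []) w = st w" if "w \<in> lists \<Sigma>" for w
    using that by (induction w rule: rev_induct) (auto simp: step)
  \<comment> \<open>The final states are the images of \<open>L\<close> under \<open>st\<close>. A
    word sharing its state with a word of \<open>L\<close> has the same quotient, and that quotient
    contains \<open>[]\<close>.\<close>
  have mem: "w \<in> L \<longleftrightarrow> st w \<in> st ` L" if "w \<in> lists \<Sigma>" for w
  proof
    assume "st w \<in> st ` L"
    then obtain v where v: "v \<in> L" "st w = st v" by blast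
    then have "left_quotient \<Sigma> w L = left_quotient \<Sigma> v L"
      using g sub that unfolding st_def by (blast dest: inj_onD)
    moreover have "[] \<in> left_quotient \<Sigma> v L" using v by (simp add: left_quotient_def)
    ultimately have "[] \<in> left_quotient \<Sigma> w L" by simp
    then show "w \<in> L" by (simp add: left_quotient_def)
  qed simp
  have "finite (st ` lists \<Sigma>)"
    using fin unfolding st_def by (metis finite_imageI image_image)
  moreover have "st [] \<in> st ` lists \<Sigma>" by simp
  moreover have "st ` L \<subseteq> st ` lists \<Sigma>" using sub by blast
  moreover have "\<forall>q\<in>st ` lists \<Sigma>. \<forall>x\<in>\<Sigma>. \<delta> q x \<in> st ` lists \<Sigma>" by (auto simp: step)
  moreover have "w \<in> L \<longleftrightarrow> w \<in> lists \<Sigma> \<and> foldl \<delta> (st []) w \<in> st ` L" for w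
    using sub run mem by (metis subsetD)
  then have "L = {w \<in> lists \<Sigma>. foldl \<delta> (st []) w \<in> st ` L}" by blast
  ultimately show ?thesis unfolding regular_language_def by blast
qed

text \<open>\<open>card\<close> is 0 on infinite sets, so a positive value already yields finiteness
  of the set of quotients.\<close>

lemma regular_if_quotient_complexity_pos:
  "L \<subseteq> lists \<Sigma> \<Longrightarrow> quotient_complexity \<Sigma> L > 0 \<Longrightarrow> regular_language \<Sigma> L"
  by (rule regular_if_finite_quotients) (auto simp: quotient_complexity_def card_gt_0_iff)

lemma regular_language_subset: "regular_language \<Sigma> L \<Longrightarrow> L \<subseteq> lists \<Sigma>"
  by (auto simp: regular_language_def)

section \<open>Quotients of prefix-free and bifix-free languages\<close>

lemma factor_free_imp_bifix_free: "factor_free L \<Longrightarrow> bifix_free L"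
  unfolding factor_free_def bifix_free_def prefix_free_def suffix_free_def
  by (meson prefix_imp_sublist suffix_imp_sublist)

lemma left_quotient_member:
  assumes "prefix_free L" and "w \<in> L"
  shows "left_quotient \<Sigma> w L = {[]}"
proof -
  have "x = []" if "w @ x \<in> L" for x
    using assms that unfolding prefix_free_def by (metis append_self_conv prefixI)
  then show ?thesis using assms by (auto simp: left_quotient_def)
qed

text \<open>A word of \<open>L\<close> leads to \<open>{[]}\<close> by prefix-freeness, and one more
  letter leads to \<open>{}\<close>.\<close>

lemma trivial_quotients:
  assumes "prefix_free L" and "L \<subseteq> lists \<Sigma>" and "L \<noteq> {}" and "\<Sigma> \<noteq> {}"
  shows "{L, {}, {[]}} \<subseteq> quotients \<Sigma> L"
proof -
  obtain w x where w: "w \<in> L" and x: "x \<in> \<Sigma>" using assms by blast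
  have "left_quotient \<Sigma> (w @ [x]) L = left_quotient \<Sigma> [x] {[]}"
    using w x assms by (simp add: left_quotient_append left_quotient_member)
  also have "\<dots> = {}" by (auto simp: left_quotient_def)
  finally have "{} \<in> quotients \<Sigma> L"
    using w x assms by (intro image_eqI[where x = "w @ [x]"]) auto
  moreover have "L \<in> quotients \<Sigma> L"
    using assms by (intro image_eqI[where x = "[]"]) (auto simp: left_quotient_Nil)
  moreover have "{[]} \<in> quotients \<Sigma> L"
    using assms w by (intro image_eqI[where x = w]) (auto simp: left_quotient_member)
  ultimately show ?thesis by blast
qed

lemma left_quotient_singleton_Nil: "left_quotient \<Sigma> w {[]} \<in> {{}, {[]}}"
  by (auto simp: left_quotient_def)

text \<open>\<open>A\<close> consists of the quotients other than \<open>L\<close>,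
  \<open>{}\<close> and \<open>{[]}\<close>. Having four quotients excludes \<open>L = {}\<close>
  and \<open>L = {[]}\<close>, so these three are distinct and removing them subtracts exactly 3. A
  nonempty \<open>w\<close> with quotient \<open>L\<close> would make each \<open>x\<close> in
  \<open>L\<close> a proper suffix of \<open>w @ x\<close> in \<open>L\<close>.\<close>

lemma quotient_structure:
  assumes bf: "bifix_free L" and sub: "L \<subseteq> lists \<Sigma>" and ne: "\<Sigma> \<noteq> {}"
    and four: "quotient_complexity \<Sigma> L \<ge> 4"
  obtains A where "finite A" "int (card A) = int (quotient_complexity \<Sigma> L) - 3"
    "\<And>X. X \<in> A \<Longrightarrow> [] \<notin> X"
    "\<And>w. w \<in> lists \<Sigma> \<Longrightarrow> w \<noteq> [] \<Longrightarrow> left_quotient \<Sigma> w L \<in> A \<union> {{}, {[]}}"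
proof -
  have pf: "prefix_free L" and sf: "suffix_free L" using bf by (auto simp: bifix_free_def)
  have card4: "card (quotients \<Sigma> L) \<ge> 4" using four by (simp add: quotient_complexity_def)
  then have fin: "finite (quotients \<Sigma> L)" by (intro card_ge_0_finite) linarith
  have "\<not> quotients \<Sigma> L \<subseteq> {{}, {[]}}"
  proof
    assume "quotients \<Sigma> L \<subseteq> {{}, {[]}}"
    then have "card (quotients \<Sigma> L) \<le> card {{}, {[] :: 'a list}}" by (intro card_mono) auto
    then show False using card4 by simp
  qed
  then have L: "L \<noteq> {}" "L \<noteq> {[]}"
    using left_quotient_singleton_Nil by (auto simp: left_quotient_def)
  define A where "A = quotients \<Sigma> L - {L, {}, {[]}}"
  have "card {L, {}, {[]}} = 3" using L by simp
  then have "card A = card (quotients \<Sigma> L) - 3"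
    unfolding A_def using trivial_quotients[OF pf sub L(1) ne] fin
    by (subst card_Diff_subset) auto
  then have "int (card A) = int (quotient_complexity \<Sigma> L) - 3"
    using four by (simp add: quotient_complexity_def)
  moreover have "finite A" using fin by (simp add: A_def)
  moreover have "[] \<notin> X" if X: "X \<in> A" for X
  proof
    assume "[] \<in> X"
    moreover obtain w where w: "X = left_quotient \<Sigma> w L" using X A_def by auto
    ultimately have "w \<in> L" by (simp add: left_quotient_def)
    then show False using X w pf by (simp add: A_def left_quotient_member)
  qed
  moreover have "left_quotient \<Sigma> w L \<in> A \<union> {{}, {[]}}" if w: "w \<in> lists \<Sigma>" "w \<noteq> []" for w
  proof -
    have "left_quotient \<Sigma> w L \<noteq> L"
    proof
      assume eq: "left_quotient \<Sigma> w L = L"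
      obtain x where x: "x \<in> L" using L by blast
      then have "w @ x \<in> L" using eq by (auto simp: left_quotient_def)
      then show False using sf x w unfolding suffix_free_def by (metis append_self_conv2 suffixI)
    qed
    then show ?thesis using w by (auto simp: A_def)
  qed
  ultimately show thesis using that by blast
qed

section \<open>Upper bounds\<close>

lemma left_quotient_Int: "left_quotient \<Sigma> w (K \<inter> L) = left_quotient \<Sigma> w K \<inter> left_quotient \<Sigma> w L"
  and left_quotient_Un: "left_quotient \<Sigma> w (K \<union> L) = left_quotient \<Sigma> w K \<union> left_quotient \<Sigma> w L"
  and left_quotient_Diff: "left_quotient \<Sigma> w (K - L) = left_quotient \<Sigma> w K - left_quotient \<Sigma> w L"
  by (auto simp: left_quotient_def)

text \<open>Pairs from \<open>A\<close> and \<open>B\<close> contribute at most (m-3)(n-3)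
  quotients, and the starting quotient, \<open>{}\<close> and \<open>{[]}\<close> at most 3. The
  operations differ in the pairs with a component \<open>{}\<close> or \<open>{[]}\<close>:
  intersection gains nothing, difference gains \<open>A\<close>, and union and symmetric difference
  gain \<open>A\<close> and \<open>B\<close>, each with and without \<open>[]\<close> added.\<close>

lemma bifix_free_boolean_bounds:
  assumes K: "bifix_free K" "K \<subseteq> lists \<Sigma>" "quotient_complexity \<Sigma> K = m"
    and L: "bifix_free L" "L \<subseteq> lists \<Sigma>" "quotient_complexity \<Sigma> L = n"
    and ne: "\<Sigma> \<noteq> {}" and "m \<ge> 4" "n \<ge> 4"
  shows "int (quotient_complexity \<Sigma> (K \<inter> L)) \<le> int m * int n - 3 * (int m + int n - 4)" (is ?I)
    and "int (quotient_complexity \<Sigma> (K - L)) \<le> int m * int n - (2 * int m + 3 * int n - 9)" (is ?D)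
    and "int (quotient_complexity \<Sigma> (K \<union> L)) \<le> int m * int n - (int m + int n)" (is ?U)
    and "int (quotient_complexity \<Sigma> (sym_diff K L)) \<le> int m * int n - (int m + int n)" (is ?S)
    and "finite (quotients \<Sigma> (K \<inter> L))" "finite (quotients \<Sigma> (K - L))"
      "finite (quotients \<Sigma> (K \<union> L))"
proof -
  obtain A where A: "finite A" "int (card A) = int m - 3" "\<And>X. X \<in> A \<Longrightarrow> [] \<notin> X"
    and KA: "\<And>w. w \<in> lists \<Sigma> \<Longrightarrow> w \<noteq> [] \<Longrightarrow> left_quotient \<Sigma> w K \<in> A \<union> {{}, {[]}}"
    using quotient_structure[of K \<Sigma>] assms by metis
  obtain B where B: "finite B" "int (card B) = int n - 3" "\<And>X. X \<in> B \<Longrightarrow> [] \<notin> X"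
    and LB: "\<And>w. w \<in> lists \<Sigma> \<Longrightarrow> w \<noteq> [] \<Longrightarrow> left_quotient \<Sigma> w L \<in> B \<union> {{}, {[]}}"
    using quotient_structure[of L \<Sigma>] assms by metis
  \<comment> \<open>Only the empty word can lead outside the pairs described by \<open>A\<close> and
    \<open>B\<close>, so the starting pair costs a single quotient instead of a row and a
    column.\<close>
  have cover: "quotients \<Sigma> M \<subseteq> S"
    if "left_quotient \<Sigma> [] M \<in> S"
      "\<And>w X Y. X \<in> A \<union> {{}, {[]}} \<Longrightarrow> Y \<in> B \<union> {{}, {[]}} \<Longrightarrow> left_quotient \<Sigma> w K = X \<Longrightarrow>
        left_quotient \<Sigma> w L = Y \<Longrightarrow> left_quotient \<Sigma> w M \<in> S" for M S
  proof
    fix Z assume "Z \<in> quotients \<Sigma> M"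
    then obtain w where w: "w \<in> lists \<Sigma>" "Z = left_quotient \<Sigma> w M" by blast
    show "Z \<in> S"
    proof (cases "w = []")
      case False
      then show ?thesis using that(2)[OF KA[OF w(1)] LB[OF w(1)] refl refl] w by simp
    qed (use that w in simp)
  qed
  define P where "P f = (\<lambda>(X, Y). f X Y) ` (A \<times> B)" for f :: "'a list set \<Rightarrow> 'a list set \<Rightarrow> 'a list set"
  have finP: "finite (P f)" for f using A B by (simp add: P_def)
  define ab where "ab = card A * card B"
  have cardP: "card (P f) \<le> ab" for f
    unfolding P_def ab_def using A B by (metis card_cartesian_product card_image_le finite_cartesian_product)
  have PI: "f X Y \<in> P f" if "X \<in> A" "Y \<in> B" for f X Y
    using that by (auto simp: P_def)
  have ab: "int ab = int m * int n - 3 * int m - 3 * int n + 9"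
    unfolding ab_def of_nat_mult A(2) B(2) by (simp add: algebra_simps)
  note un = order_trans[OF card_Un_le add_mono]
  have le: "finite C \<Longrightarrow> quotients \<Sigma> M \<subseteq> C \<Longrightarrow> card C \<le> k \<Longrightarrow>
      finite (quotients \<Sigma> M) \<and> quotient_complexity \<Sigma> M \<le> k" for M C k
    unfolding quotient_complexity_def using card_mono finite_subset le_trans by metis
  have triv: "card {Z, {}, {[] :: 'a list}} \<le> 3" for Z
    by (simp add: card_insert_if)

  have "finite (quotients \<Sigma> (K \<inter> L)) \<and>
    quotient_complexity \<Sigma> (K \<inter> L) \<le> ab + 3"
  proof (rule le)
    show "quotients \<Sigma> (K \<inter> L) \<subseteq> P (\<inter>) \<union> {left_quotient \<Sigma> [] (K \<inter> L), {}, {[]}}"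
      by (rule cover) (use A(3) B(3) PI[of _ _ "(\<inter>)"] in \<open>auto simp: left_quotient_Int\<close>)
    show "card (P (\<inter>) \<union> {left_quotient \<Sigma> [] (K \<inter> L), {}, {[]}}) \<le> ab + 3"
      by (intro un cardP triv)
  qed (simp add: finP)
  note fin_le = this
  show ?I using of_nat_mono[OF conjunct2[OF fin_le], where 'a = int] ab by (simp add: algebra_simps)
  show "finite (quotients \<Sigma> (K \<inter> L))" using fin_le by blast

  have "finite (quotients \<Sigma> (K - L)) \<and>
    quotient_complexity \<Sigma> (K - L) \<le> ab + card A + 3"
  proof (rule le)
    show "quotients \<Sigma> (K - L) \<subseteq> P (-) \<union> A \<union> {left_quotient \<Sigma> [] (K - L), {}, {[]}}"
      by (rule cover) (use A(3) B(3) PI[of _ _ "(-)"] in \<open>auto simp: left_quotient_Diff\<close>)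
    show "card (P (-) \<union> A \<union> {left_quotient \<Sigma> [] (K - L), {}, {[]}}) \<le> ab + card A + 3"
      by (intro un cardP triv order_refl)
  qed (simp add: finP A)
  note fin_le = this
  show ?D using A(2) of_nat_mono[OF conjunct2[OF fin_le], where 'a = int] ab by (simp add: algebra_simps)
  show "finite (quotients \<Sigma> (K - L))" using fin_le by blast

  \<comment> \<open>One cover serves union and symmetric difference: against \<open>{}\<close> a
    quotient is unchanged, and against \<open>{[]}\<close> it acquires \<open>[]\<close>, for the
    symmetric difference because members of \<open>A\<close> and \<open>B\<close> lack
    \<open>[]\<close>.\<close>
  define C where "C f Z = P f \<union> A \<union> B \<union> insert [] ` A \<union> insert [] ` B \<union> {Z, {}, {[]}}" for f Z
  have finC: "finite (C f Z)" for f Z using A B by (simp add: C_def finP)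
  have cardC: "card (C f Z) \<le> ab + card A + card B + card A + card B + 3" for f Z
    unfolding C_def using A B by (intro un cardP triv order_refl card_image_le)

  have "finite (quotients \<Sigma> (K \<union> L)) \<and>
    quotient_complexity \<Sigma> (K \<union> L) \<le> ab + card A + card B + card A + card B + 3"
  proof (rule le[OF finC _ cardC])
    show "quotients \<Sigma> (K \<union> L) \<subseteq> C (\<union>) (left_quotient \<Sigma> [] (K \<union> L))"
      by (rule cover) (use PI[of _ _ "(\<union>)"] in \<open>auto simp: left_quotient_Un C_def\<close>)
  qed
  note fin_le = this
  show ?U using A(2) B(2) of_nat_mono[OF conjunct2[OF fin_le], where 'a = int] ab by (simp add: algebra_simps)
  show "finite (quotients \<Sigma> (K \<union> L))" using fin_le by blast

  define sd where "sd = (\<lambda>X Y :: 'a list set. sym_diff X Y)"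
  have lq_sd: "left_quotient \<Sigma> w (sym_diff K L) = sd (left_quotient \<Sigma> w K) (left_quotient \<Sigma> w L)" for w
    by (auto simp: left_quotient_def sd_def)
  have sd_simps: "sd X {} = X" "sd {} X = X" "sd {[]} {[]} = {}" for X
    by (auto simp: sd_def)
  have sdA: "sd X {[]} = insert [] X" if "X \<in> A" for X using A(3)[OF that] by (auto simp: sd_def)
  have sdB: "sd {[]} Y = insert [] Y" if "Y \<in> B" for Y using B(3)[OF that] by (auto simp: sd_def)
  have "finite (quotients \<Sigma> (sym_diff K L)) \<and>
    quotient_complexity \<Sigma> (sym_diff K L) \<le> ab + card A + card B + card A + card B + 3"
  proof (rule le[OF finC _ cardC])
    show "quotients \<Sigma> (sym_diff K L) \<subseteq> C sd (left_quotient \<Sigma> [] (sym_diff K L))"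
      by (rule cover) (use PI[of _ _ sd] in \<open>auto simp: lq_sd sd_simps sdA sdB C_def\<close>)
  qed
  note fin_le = this
  show ?S using A(2) B(2) of_nat_mono[OF conjunct2[OF fin_le], where 'a = int] ab by (simp add: algebra_simps)
qed

section \<open>The witness languages\<close>

text \<open>These are the words after the opening \<open>c\<close>. The terminator \<open>e\<close>
  is \<open>c\<close> or the counted letter itself, and \<open>k\<close> counts only the letters
  \<open>a\<close> before it. Exchanging \<open>a\<close> and \<open>b\<close> gives the second
  language.\<close>

definition counting_words :: "'a \<Rightarrow> 'a \<Rightarrow> 'a \<Rightarrow> nat \<Rightarrow> 'a list set" where
  "counting_words a b e k = {w @ [e] | w. w \<in> lists {a, b} \<and> count_list w a = k}"

lemma snoc_in_counting_words:
  "w @ [x] \<in> counting_words a b e k \<longleftrightarrow> x = e \<and> w \<in> lists {a, b} \<and> count_list w a = k"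
  by (auto simp: counting_words_def)

text \<open>Reading \<open>u\<close> only lowers the remaining count. The guard is there because
  natural subtraction truncates, and \<open>v\<close> is nonempty so that the terminator lies in
  \<open>v\<close>.\<close>

lemma append_in_counting_words:
  "v \<noteq> [] \<Longrightarrow> u @ v \<in> counting_words a b e k \<longleftrightarrow>
    u \<in> lists {a, b} \<and> count_list u a \<le> k \<and> v \<in> counting_words a b e (k - count_list u a)"
  by (cases v rule: rev_cases) (auto simp: snoc_in_counting_words simp flip: append_assoc)

lemma Nil_notin_counting_words: "[] \<notin> counting_words a b e k"
  by (simp add: counting_words_def)

text \<open>If \<open>v = p @ u @ s\<close> with both words in \<open>L\<close>, equal counts leave
  no \<open>x\<close> in \<open>p\<close> and no \<open>y\<close> in \<open>s\<close>. Since
  \<open>v\<close> starts with \<open>x\<close> and ends with \<open>y\<close>, both parts are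
  empty.\<close>

lemma factor_free_if_const_counts:
  assumes start: "\<And>w. w \<in> L \<Longrightarrow> w \<noteq> [] \<and> hd w = x \<and> last w = y"
    and cx: "\<And>w. w \<in> L \<Longrightarrow> count_list w x = i"
    and cy: "\<And>w. w \<in> L \<Longrightarrow> count_list w y = j"
  shows "factor_free L"
  unfolding factor_free_def
proof (intro ballI impI)
  fix u v assume u: "u \<in> L" and v: "v \<in> L" and "sublist u v"
  then obtain p s where v_eq: "v = p @ u @ s" by (auto simp: sublist_def)
  have "count_list p x = 0" using cx[OF u] cx[OF v] by (simp add: v_eq)
  then have p: "p = []" using start[OF v] by (cases p) (auto simp: v_eq split: if_splits)
  have "count_list s y = 0" using cy[OF u] cy[OF v] by (simp add: v_eq)
  then have s: "s = []" using start[OF v] by (cases s rule: rev_cases) (auto simp: v_eq split: if_splits)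
  show "u = v" by (simp add: v_eq p s)
qed

lemma count_list_replicate: "count_list (replicate k y) x = (if x = y then k else 0)"
  by (induction k) auto

lemma count_list_counting_words:
  assumes "distinct [a, b, c]" and "w \<in> counting_words a b e k"
  shows "count_list w a = k + of_bool (e = a)" and "count_list w c = of_bool (e = c)"
proof -
  obtain v where "w = v @ [e]" "v \<in> lists {a, b}" "count_list v a = k"
    using assms by (auto simp: counting_words_def)
  moreover from this have "c \<notin> set v" using assms by auto
  ultimately show "count_list w a = k + of_bool (e = a)" "count_list w c = of_bool (e = c)"
    by (auto simp: count_list_0_iff)
qed

text \<open>The first letter \<open>c\<close> and the last letter \<open>e\<close> both occur a
  fixed number of times. This would fail for \<open>e = b\<close>, whose number of occurrences is
  free.\<close>

lemma factor_free_counting_words: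
  assumes "distinct [a, b, c]" and "e \<in> {a, c}"
  shows "factor_free ((#) c ` counting_words a b e k)"
proof (rule factor_free_if_const_counts)
  fix w assume "w \<in> (#) c ` counting_words a b e k"
  then obtain v where v: "w = c # v" "v \<in> counting_words a b e k" by blast
  then show "w \<noteq> [] \<and> hd w = c \<and> last w = e"
    by (auto simp: counting_words_def)
  show "count_list w c = Suc (of_bool (e = c))"
    using count_list_counting_words[OF assms(1) v(2)] v by simp
  show "count_list w e = (if e = a then k + 1 else 2)"
    using count_list_counting_words[OF assms(1) v(2)] v assms by auto
qed

lemma counting_words_subset:
  "{a, b, e} \<subseteq> \<Sigma> \<Longrightarrow> counting_words a b e k \<subseteq> lists \<Sigma>"
  by (auto simp: counting_words_def)

lemma Cons_counting_words_subset:
  "{a, b, c, e} \<subseteq> \<Sigma> \<Longrightarrow> (#) c ` counting_words a b e k \<subseteq> lists \<Sigma>"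
  by (auto simp: counting_words_def)

lemma replicate_in_counting_words:
  "replicate k a @ [e] \<in> counting_words a b e k' \<longleftrightarrow> k = k'"
  by (auto simp: snoc_in_counting_words count_list_replicate)

lemma left_quotient_counting_words_step:
  assumes "distinct [a, b, c]" and "e \<in> {a, c}" and "{a, b, c} \<subseteq> \<Sigma>"
  shows "left_quotient \<Sigma> [x] (counting_words a b e k) \<in> counting_words a b e ` {..k} \<union> {{}, {[]}}"
proof -
  let ?M = "counting_words a b e"
  have sub: "?M j \<subseteq> lists \<Sigma>" for j using assms by (intro counting_words_subset) auto
  have 1: "x # v \<in> ?M k \<longleftrightarrow> x \<in> {a, b} \<and> count_list [x] a \<le> k \<and> v \<in> ?M (k - count_list [x] a)" if "v \<noteq> []" for v
    using append_in_counting_words[OF that, of "[x]"] by simp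
  have 2: "[x] \<in> ?M k \<longleftrightarrow> x = e \<and> k = 0"
    using snoc_in_counting_words[of "[]" x] by auto
  have "left_quotient \<Sigma> [x] (?M k) =
    (if x = e \<and> k = 0 then {[]} else {}) \<union>
    (if x \<in> {a, b} \<and> count_list [x] a \<le> k then ?M (k - count_list [x] a) else {})"
  proof (rule set_eqI)
    fix v
    show "v \<in> left_quotient \<Sigma> [x] (?M k) \<longleftrightarrow> v \<in> (if x = e \<and> k = 0 then {[]} else {}) \<union>
    (if x \<in> {a, b} \<and> count_list [x] a \<le> k then ?M (k - count_list [x] a) else {})"
      using 1[of v] 2 sub Nil_notin_counting_words[of a b e]
      by (cases "v = []") (auto simp: left_quotient_def)
  qed
  \<comment> \<open>The two parts of the union are never both present: for \<open>e = c\<close> the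
    letter is not in \<open>{a, b}\<close>, and for \<open>e = a\<close> the count 0 allows no
    further \<open>a\<close> before the terminator.\<close>
  moreover have "\<not> (x \<in> {a, b} \<and> count_list [x] a \<le> k)" if "x = e \<and> k = 0"
    using assms that by auto
  ultimately show ?thesis by auto
qed

text \<open>After the opening \<open>c\<close> the quotient is determined by the number
  \<open>j \<le> r\<close> of letters \<open>a\<close> still due, which gives \<open>r + 1\<close>
  quotients besides the language itself, \<open>{}\<close> and \<open>{[]}\<close>.\<close>

lemma quotient_complexity_counting_words:
  assumes "distinct [a, b, c]" and "e \<in> {a, c}" and "{a, b, c} \<subseteq> \<Sigma>"
  shows "quotient_complexity \<Sigma> ((#) c ` counting_words a b e r) = r + 4"
proof -
  let ?M = "counting_words a b e"
  let ?K = "(#) c ` ?M r"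
  have sub: "?M j \<subseteq> lists \<Sigma>" for j using assms by (intro counting_words_subset) auto
  have subK: "?K \<subseteq> lists \<Sigma>" using assms by (intro Cons_counting_words_subset) auto
  have ne: "?M j \<noteq> {}" for j using replicate_in_counting_words[of j a e b j] by auto
  have pf: "prefix_free ?K"
    using factor_free_counting_words[OF assms(1,2)] factor_free_imp_bifix_free bifix_free_def by blast
  define S where "S = ?M ` {..r} \<union> {?K, {}, {[]}}"
  have "quotients \<Sigma> ?K = S"
  proof
    have "left_quotient \<Sigma> [x] X \<in> S" if XS: "X \<in> S" for X x
    proof -
      consider j where "j \<le> r" "X = ?M j" | "X = ?K" | "X \<in> {{}, {[]}}" using XS unfolding S_def by blast
      then show ?thesis
      proof cases
        case 1
        then show ?thesis using left_quotient_counting_words_step[OF assms, of x j]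
          by (auto simp: S_def)
      next
        case 2
        then have "left_quotient \<Sigma> [x] X = (if x = c then ?M r else {})"
          using sub by (auto simp: left_quotient_def)
        then show ?thesis by (auto simp: S_def)
      qed (auto simp: S_def left_quotient_def)
    qed
    then show "quotients \<Sigma> ?K \<subseteq> S"
      using left_quotient_closed[OF subK, of S] by (blast intro: S_def[THEN equalityD2, THEN subsetD])
    have "?M j \<in> quotients \<Sigma> ?K" if "j \<le> r" for j
    proof (rule image_eqI)
      have "c # replicate (r - j) a @ v \<in> ?K \<longleftrightarrow> v \<in> ?M j" for v
      \<comment> \<open>The word \<open>c a^(r-j)\<close> is incomplete: its tail lacks the closing
        \<open>c\<close> if \<open>e = c\<close>, and has fewer than \<open>r + 1\<close> letters
        \<open>a\<close> if \<open>e = a\<close>.\<close>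
      proof (cases "v = []")
        case True
        then have "c # replicate (r - j) a @ v \<notin> ?K"
          using count_list_counting_words[OF assms(1), of "replicate (r - j) a" e r] assms(1,2)
          by (auto simp: of_bool_def count_list_replicate split: if_splits)
        then show ?thesis using True by (simp add: Nil_notin_counting_words)
      next
        case False
        then show ?thesis using that append_in_counting_words[OF False, of "replicate (r - j) a" a b e r]
          by (auto simp: count_list_replicate)
      qed
      then show "?M j = left_quotient \<Sigma> (c # replicate (r - j) a) ?K"
        using sub by (auto simp: left_quotient_def)
    qed (use assms in auto)
    then show "S \<subseteq> quotients \<Sigma> ?K"
      using trivial_quotients[OF pf subK] ne assms(3) by (auto simp: S_def)
  qed
  moreover have "card S = r + 4"
  proof -
    have inj: "inj_on ?M {..r}"
      by (rule inj_onI) (metis replicate_in_counting_words)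
    have "replicate j a @ [e] \<notin> ?K" for j
      using assms Nil_notin_counting_words[of a b e r] by (cases j) auto
    then have "?M j \<noteq> ?K" for j using replicate_in_counting_words[of j a e b j] by auto
    moreover have "?M j \<noteq> {[]}" for j
      using Nil_notin_counting_words[of a b e j] by blast
    ultimately have "?M j \<notin> {?K, {}, {[]}}" for j using ne by simp
    then have "?M ` {..r} \<inter> {?K, {}, {[]}} = {}" by blast
    moreover have "?K \<noteq> {}" "?K \<noteq> {[]}" using ne by blast+
    then have "card {?K, {}, {[]}} = 3" by simp
    ultimately have "?M ` {..r} \<inter> {?K, {}, {[]}} = {}" "card {?K, {}, {[]}} = 3" by simp_all
    then show ?thesis using inj unfolding S_def by (subst card_Un_disjoint) (auto simp: card_image)
  qed
  ultimately show ?thesis by (simp add: quotient_complexity_def)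
qed

section \<open>Lower bounds\<close>

text \<open>The word \<open>x\<close> in the last hypothesis separates the quotient reached by
  \<open>f g\<close> from the three trivial ones: it is nonempty and accepted, which excludes
  \<open>{}\<close> and \<open>{[]}\<close>, and it is not in \<open>D\<close>.\<close>

lemma quotient_complexity_lower_bound:
  assumes fin: "finite (quotients \<Sigma> D)" and triv: "{D, {}, {[]}} \<subseteq> quotients \<Sigma> D"
    and "finite G" "G \<noteq> {}"
    and f: "\<And>g. g \<in> G \<Longrightarrow> f g \<in> lists \<Sigma>"
    and inj: "inj_on (\<lambda>g. left_quotient \<Sigma> (f g) D) G"
    and ex: "\<And>g. g \<in> G \<Longrightarrow> \<exists>x \<in> lists \<Sigma>. x \<noteq> [] \<and> x \<notin> D \<and> f g @ x \<in> D"
  shows "card G + 3 \<le> quotient_complexity \<Sigma> D"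
proof -
  let ?q = "\<lambda>g. left_quotient \<Sigma> (f g) D"
  have q: "?q g \<noteq> D \<and> ?q g \<noteq> {} \<and> ?q g \<noteq> {[]}" if g: "g \<in> G" for g
  proof -
    obtain x where "x \<in> lists \<Sigma>" "x \<noteq> []" "x \<notin> D" "f g @ x \<in> D" using ex[OF g] by blast
    then have "x \<in> ?q g" "x \<notin> D" "x \<noteq> []" by (auto simp: left_quotient_def)
    then show ?thesis by blast
  qed
  obtain g x where "g \<in> G" "x \<noteq> []" "f g @ x \<in> D" using ex \<open>G \<noteq> {}\<close> by blast
  then have "D \<noteq> {}" "D \<noteq> {[]}" by auto
  then have "card (?q ` G \<union> {D, {}, {[]}}) = card G + 3"
    using q inj \<open>finite G\<close> by (subst card_Un_disjoint) (auto simp: card_image)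
  moreover have "?q ` G \<union> {D, {}, {[]}} \<subseteq> quotients \<Sigma> D" using f triv by blast
  ultimately show ?thesis using card_mono[OF fin] unfolding quotient_complexity_def by metis
qed

lemma prefix_free_subset: "prefix_free L \<Longrightarrow> D \<subseteq> L \<Longrightarrow> prefix_free D"
  unfolding prefix_free_def by blast

lemma left_quotient_eqD:
  "left_quotient \<Sigma> u D = left_quotient \<Sigma> v D \<Longrightarrow> x \<in> lists \<Sigma> \<Longrightarrow> u @ x \<in> D \<longleftrightarrow> v @ x \<in> D"
  unfolding left_quotient_def by blast

text \<open>The word \<open>c a^i b^j\<close> advances the two counters independently. The
  difference gains the column \<open>j = t + 1\<close>, where \<open>L\<close> can no longer accept
  while \<open>K\<close> still can.\<close>

lemma intersection_difference_lower_bounds: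
  fixes a b c :: 'a and r t :: nat
  assumes abc: "distinct [a, b, c]" "{a, b, c} \<subseteq> \<Sigma>"
  defines "K \<equiv> (#) c ` counting_words a b c r" and "L \<equiv> (#) c ` counting_words b a c t"
  shows "finite (quotients \<Sigma> (K \<inter> L)) \<Longrightarrow>
      Suc r * Suc t + 3 \<le> quotient_complexity \<Sigma> (K \<inter> L)" (is "_ \<Longrightarrow> ?I")
    and "finite (quotients \<Sigma> (K - L)) \<Longrightarrow>
      Suc r * Suc (Suc t) + 3 \<le> quotient_complexity \<Sigma> (K - L)" (is "_ \<Longrightarrow> ?D")
proof -
  define f where "f = (\<lambda>(i, j). c # replicate i a @ replicate j b)"
  define x where "x k l = replicate k a @ replicate l b @ [c]" for k l
  have fK: "f (i, j) @ x k l \<in> K \<longleftrightarrow> i + k = r" for i j k l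
    using abc snoc_in_counting_words[of "replicate i a @ replicate j b @ replicate k a @ replicate l b" c a b c r]
    by (auto simp: f_def x_def K_def count_list_replicate)
  have fL: "f (i, j) @ x k l \<in> L \<longleftrightarrow> j + l = t" for i j k l
    using abc snoc_in_counting_words[of "replicate i a @ replicate j b @ replicate k a @ replicate l b" c b a c t]
    by (auto simp: f_def x_def L_def count_list_replicate)
  have f: "f g \<in> lists \<Sigma>" for g using abc by (auto simp: f_def split: prod.split)
  have x: "x k l \<in> lists \<Sigma>" "x k l \<noteq> []" for k l using abc by (auto simp: x_def)
  \<comment> \<open>A test word contains one \<open>c\<close>, a word of \<open>K\<close>
    two.\<close>
  have xK: "x k l \<notin> K" for k l
  proof
    assume "x k l \<in> K"
    then obtain v where v: "x k l = c # v" "v \<in> counting_words a b c r" by (auto simp: K_def)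
    then have "count_list (x k l) c = 2" using count_list_counting_words(2)[OF abc(1) v(2)] by simp
    then show False using abc by (auto simp: x_def count_list_replicate)
  qed
  have pf: "prefix_free K"
    using factor_free_counting_words[OF abc(1), of c r] factor_free_imp_bifix_free bifix_free_def K_def by auto
  have sub: "K \<subseteq> lists \<Sigma>" unfolding K_def using abc by (intro Cons_counting_words_subset) auto
  have triv: "{D, {}, {[]}} \<subseteq> quotients \<Sigma> D" if "D \<subseteq> K" "D \<noteq> {}" for D
    using that sub abc by (intro trivial_quotients prefix_free_subset[OF pf]) auto

  show ?I if fin: "finite (quotients \<Sigma> (K \<inter> L))"
  proof -
    have "f (0, 0) @ x r t \<in> K \<inter> L" by (simp add: fK fL)
    then have "{K \<inter> L, {}, {[]}} \<subseteq> quotients \<Sigma> (K \<inter> L)" by (intro triv) auto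
    then have "card ({..r} \<times> {..t}) + 3 \<le> quotient_complexity \<Sigma> (K \<inter> L)"
    proof (rule quotient_complexity_lower_bound[OF fin])
      show "inj_on (\<lambda>g. left_quotient \<Sigma> (f g) (K \<inter> L)) ({..r} \<times> {..t})"
      proof (rule inj_onI, clarify)
        fix i j i' j' assume "i \<le> r" "j \<le> t"
          and eq: "left_quotient \<Sigma> (f (i, j)) (K \<inter> L) = left_quotient \<Sigma> (f (i', j')) (K \<inter> L)"
        then show "i = i' \<and> j = j'"
          using left_quotient_eqD[OF eq x(1), of "r - i" "t - j"] by (auto simp: fK fL)
      qed
      fix g assume "g \<in> {..r} \<times> {..t}"
      then have "f g @ x (r - fst g) (t - snd g) \<in> K \<inter> L" by (cases g) (simp add: fK fL)
      then show "\<exists>y\<in>lists \<Sigma>. y \<noteq> [] \<and> y \<notin> K \<inter> L \<and> f g @ y \<in> K \<inter> L" using x xK by blast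
    qed (use f in auto)
    then show ?thesis by simp
  qed

  show ?D if fin: "finite (quotients \<Sigma> (K - L))"
  proof -
    have "f (0, 0) @ x r (Suc t) \<in> K - L" by (simp add: fK fL)
    then have "{K - L, {}, {[]}} \<subseteq> quotients \<Sigma> (K - L)" by (intro triv) auto
    then have "card ({..r} \<times> {..Suc t}) + 3 \<le> quotient_complexity \<Sigma> (K - L)"
    proof (rule quotient_complexity_lower_bound[OF fin])
      show "inj_on (\<lambda>g. left_quotient \<Sigma> (f g) (K - L)) ({..r} \<times> {..Suc t})"
      proof (rule inj_onI, clarify)
        fix i j i' j' assume ij: "i \<le> r" "j \<le> Suc t" "i' \<le> r" "j' \<le> Suc t"
          and eq: "left_quotient \<Sigma> (f (i, j)) (K - L) = left_quotient \<Sigma> (f (i', j')) (K - L)"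
        note test = left_quotient_eqD[OF eq x(1), unfolded Diff_iff fK fL]
        \<comment> \<open>Adding \<open>t + 1\<close> letters \<open>b\<close> rules out
          \<open>L\<close> for every \<open>j\<close>, so this test sees \<open>i\<close>
          alone.\<close>
        have "i = i'" using ij test[of "r - i" "Suc t"] by auto
        \<comment> \<open>Both tests are used because \<open>t - j\<close> truncates when
          \<open>j = t + 1\<close>; then the test built from \<open>j'\<close> decides.\<close>
        moreover have "j = j'"
          using ij \<open>i = i'\<close> test[of "r - i" "t - j"] test[of "r - i" "t - j'"]
          by (auto simp: le_Suc_eq)
        ultimately show "i = i' \<and> j = j'" by simp
      qed
      fix g assume "g \<in> {..r} \<times> {..Suc t}"
      then have "f g @ x (r - fst g) (Suc t) \<in> K - L" by (cases g) (simp add: fK fL)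
      then show "\<exists>y\<in>lists \<Sigma>. y \<noteq> [] \<and> y \<notin> K - L \<and> f g @ y \<in> K - L" using x xK by blast
    qed (use f in auto)
    then show ?thesis by simp
  qed
qed

lemma in_counting_words_iff:
  "a \<noteq> b \<Longrightarrow> w \<in> counting_words a b a k \<longleftrightarrow>
    w \<in> lists {a, b} \<and> w \<noteq> [] \<and> last w = a \<and> count_list w a = Suc k"
  by (cases w rule: rev_cases) (auto simp: snoc_in_counting_words Nil_notin_counting_words)

text \<open>After \<open>c\<close> each language is in a nonfinal, the final or the empty state, a
  grid of \<open>(r + 3) * (t + 3)\<close> pairs. The four pairs without a nonfinal component yield
  only \<open>{}\<close> and \<open>{[]}\<close>; with the starting quotient the count is 4 less and
  3 more.\<close>

lemma union_lower_bound:
  fixes a b c :: 'a and r t :: nat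
  assumes abc: "distinct [a, b, c]" "{a, b, c} \<subseteq> \<Sigma>"
  defines "K \<equiv> (#) c ` counting_words a b a r" and "L \<equiv> (#) c ` counting_words b a b t"
  assumes fin: "finite (quotients \<Sigma> (K \<union> L))"
  shows "(r + 3) * (t + 3) - 1 \<le> quotient_complexity \<Sigma> (K \<union> L)"
proof -
  let ?D = "K \<union> L"
  let ?a = "\<lambda>i. replicate i a" and ?b = "\<lambda>j. replicate j b"
  have memK: "c # w \<in> K \<longleftrightarrow> w \<in> lists {a, b} \<and> w \<noteq> [] \<and> last w = a \<and> count_list w a = Suc r" for w
    using abc in_counting_words_iff[of a b w r] by (auto simp: K_def)
  have memL: "c # w \<in> L \<longleftrightarrow> w \<in> lists {a, b} \<and> w \<noteq> [] \<and> last w = b \<and> count_list w b = Suc t" for w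
    using abc in_counting_words_iff[of b a w t] by (auto simp: L_def)
  have sub: "?D \<subseteq> lists \<Sigma>"
    unfolding K_def L_def using abc by (intro Un_least Cons_counting_words_subset) auto
  \<comment> \<open>\<open>r + 1\<close> and \<open>r + 2\<close> stand for the final and the empty state of \<open>K\<close>, similarly for \<open>L\<close>. When one
    language has left its nonfinal states, its own letters must come last, because the other
    letter would take it from the final to the empty state; hence the case split in \<open>f\<close>.\<close>
  define G where "G = {..r + 2} \<times> {..t + 2} - {r + 1, r + 2} \<times> {t + 1, t + 2}"
  have G: "(i, j) \<in> G \<longleftrightarrow> i \<le> r + 2 \<and> j \<le> t + 2 \<and> (i \<le> r \<or> j \<le> t)" for i j
    by (auto simp: G_def)
  define f where "f = (\<lambda>(i, j). if i \<le> r then c # ?a i @ ?b j else c # ?b j @ ?a i)"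
  \<comment> \<open>A test ending in \<open>a\<close> is rejected by \<open>L\<close> and sees only
    \<open>i\<close>; one ending in \<open>b\<close> sees only \<open>j\<close>. The closing letter
    is itself counted, hence \<open>Suc k\<close> and \<open>Suc l\<close>.\<close>
  have testK: "f (i, j) @ ?b (Suc l) @ ?a (Suc k) \<in> ?D \<longleftrightarrow> i + k = r" for i j k l
    using abc by (auto simp: f_def memK memL count_list_replicate)
  have testL: "f (i, j) @ ?a (Suc k) @ ?b (Suc l) \<in> ?D \<longleftrightarrow> j + l = t" for i j k l
    using abc by (auto simp: f_def memK memL count_list_replicate)
  \<comment> \<open>The empty test tells the final state from the empty one, which
    \<open>testK\<close> and \<open>testL\<close> cannot do.\<close>
  have testNil: "f (i, j) \<in> ?D \<longleftrightarrow> i = Suc r \<or> j = Suc t" if "(i, j) \<in> G" "i > r \<or> j > t" for i j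
    using abc that by (auto simp: f_def memK memL count_list_replicate G)
  have ab: "?a k @ ?b l \<in> lists \<Sigma>" "?b l @ ?a k \<in> lists \<Sigma>" for k l
    using abc by auto
  \<comment> \<open>The union is not prefix-free: \<open>c a^(r+1)\<close> in \<open>K\<close> is a
    prefix of \<open>c a^(r+1) b^(t+1)\<close> in \<open>L\<close>. The trivial quotients are
    therefore reached explicitly, by first exhausting \<open>L\<close> with \<open>t + 2\<close>
    letters \<open>b\<close> and then completing or overrunning \<open>K\<close>.\<close>
  have "{?D, {}, {[]}} \<subseteq> quotients \<Sigma> ?D"
  proof -
    have "left_quotient \<Sigma> [] ?D = ?D" using sub by (rule left_quotient_Nil)
    moreover have "left_quotient \<Sigma> (c # ?b (t + 2) @ ?a (r + 1)) ?D = {[]}"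
    proof -
      have "v = []" if "c # ?b (t + 2) @ ?a (r + 1) @ v \<in> ?D" for v
      proof (rule ccontr)
        assume "v \<noteq> []"
        then have "count_list v (last v) > 0" by (simp add: count_list_0_iff flip: neq0_conv)
        then show False using that \<open>v \<noteq> []\<close> abc
          by (auto simp: memK memL count_list_replicate)
      qed
      moreover have "c # ?b (t + 2) @ ?a (r + 1) \<in> ?D"
        using abc by (auto simp: memK count_list_replicate)
      ultimately show ?thesis by (auto simp: left_quotient_def)
    qed
    moreover have "left_quotient \<Sigma> (c # ?b (t + 2) @ ?a (r + 2)) ?D = {}"
      using abc by (auto simp: left_quotient_def memK memL count_list_replicate)
    moreover have "c # ?b j @ ?a i \<in> lists \<Sigma>" for i j using abc by auto
    ultimately show ?thesis by (metis empty_subsetI image_eqI insert_subset lists.Nil)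
  qed
  then have "card G + 3 \<le> quotient_complexity \<Sigma> ?D"
  proof (rule quotient_complexity_lower_bound[OF fin])
    show "finite G" by (simp add: G_def)
    show "G \<noteq> {}" using G[of 0 0] by blast
    show "f g \<in> lists \<Sigma>" for g using abc by (auto simp: f_def split: prod.split)
    show "inj_on (\<lambda>g. left_quotient \<Sigma> (f g) ?D) G"
    proof (rule inj_onI, clarify)
      fix i j i' j' assume ij: "(i, j) \<in> G" "(i', j') \<in> G"
        and eq: "left_quotient \<Sigma> (f (i, j)) ?D = left_quotient \<Sigma> (f (i', j')) ?D"
      note test = left_quotient_eqD[OF eq]
      have i: "i + k = r \<longleftrightarrow> i' + k = r" for k
        using test[OF ab(2)[of "Suc 0" "Suc k"]] unfolding testK .
      have j: "j + l = t \<longleftrightarrow> j' + l = t" for l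
        using test[OF ab(1)[of "Suc 0" "Suc l"]] unfolding testL .
      have Nil: "f (i, j) \<in> ?D \<longleftrightarrow> f (i', j') \<in> ?D" using test[of "[]"] by simp
      have i_le: "i = i'" if "i \<le> r \<or> i' \<le> r"
        using that i[of "r - i"] i[of "r - i'"] by auto
      have j_le: "j = j'" if "j \<le> t \<or> j' \<le> t"
        using that j[of "t - j"] j[of "t - j'"] by auto
      \<comment> \<open>Distinct values beyond \<open>r\<close> are \<open>r + 1\<close> and
        \<open>r + 2\<close>. Membership in \<open>G\<close> then forces \<open>j\<close> and
        \<open>j'\<close> to be at most \<open>t\<close>, so the empty test separates them.\<close>
      have "i = i'"
      proof (rule ccontr)
        assume "i \<noteq> i'"
        then have "\<not> (i \<le> r \<or> i' \<le> r)" using i_le by blast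
        then have "i > r" "i' > r" by auto
        then show False using \<open>i \<noteq> i'\<close> ij j_le Nil testNil[of i j] testNil[of i' j'] by (auto simp: G)
      qed
      moreover have "j = j'"
      proof (rule ccontr)
        assume "j \<noteq> j'"
        then have "\<not> (j \<le> t \<or> j' \<le> t)" using j_le by blast
        then have "j > t" "j' > t" by auto
        then show False using \<open>j \<noteq> j'\<close> ij i_le Nil testNil[of i j] testNil[of i' j'] by (auto simp: G)
      qed
      ultimately show "i = i' \<and> j = j'" by simp
    qed
    fix g assume "g \<in> G"
    then obtain i j where g: "g = (i, j)" "i \<le> r \<or> j \<le> t" using G by (cases g) auto
    have D: "hd y = c" if "y \<in> ?D" for y using that by (auto simp: K_def L_def)
    show "\<exists>y\<in>lists \<Sigma>. y \<noteq> [] \<and> y \<notin> ?D \<and> f g @ y \<in> ?D"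
      using g(2)
    proof
      assume "i \<le> r"
      then have "f g @ ?b (Suc 0) @ ?a (Suc (r - i)) \<in> ?D" unfolding g testK by simp
      moreover have "?b (Suc 0) @ ?a (Suc (r - i)) \<notin> ?D" using D abc by fastforce
      ultimately show ?thesis
        by (intro bexI[of _ "?b (Suc 0) @ ?a (Suc (r - i))"] conjI ab) simp_all
    next
      assume "j \<le> t"
      then have "f g @ ?a (Suc 0) @ ?b (Suc (t - j)) \<in> ?D" unfolding g testL by simp
      moreover have "?a (Suc 0) @ ?b (Suc (t - j)) \<notin> ?D" using D abc by fastforce
      ultimately show ?thesis
        by (intro bexI[of _ "?a (Suc 0) @ ?b (Suc (t - j))"] conjI ab) simp_all
    qed
  qed
  moreover have "card G = (r + 3) * (t + 3) - 4"
  proof -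
    have "card ({..r + 2} \<times> {..t + 2}) = (r + 3) * (t + 3)"
      by (simp add: numeral_3_eq_3)
    moreover have "card ({r + 1, r + 2} \<times> {t + 1, t + 2}) = 4" by simp
    ultimately show ?thesis unfolding G_def by (subst card_Diff_subset) auto
  qed
  ultimately show ?thesis by (simp add: algebra_simps)
qed

text \<open>The last letters differ. Hence symmetric difference and union coincide on these
  witnesses.\<close>

lemma disjoint_counting_words:
  "a \<noteq> b \<Longrightarrow> (#) c ` counting_words a b a r \<inter> (#) c ` counting_words b a b t = {}"
  using in_counting_words_iff[of a b] in_counting_words_iff[of b a] by fastforce

section \<open>Tightness and the theorem\<close>

text \<open>The upper bounds are used twice: for the inequality itself and for the finiteness that
  the lower bounds require.\<close>

lemma factor_free_tight:
  assumes abc: "distinct [a, b, c]" "{a, b, c} \<subseteq> \<Sigma>" and "m \<ge> 4" "n \<ge> 4"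
  obtains K L K' L' where
    "\<forall>M \<in> {K, L, K', L'}. regular_language \<Sigma> M \<and> factor_free M"
    "\<forall>M \<in> {K, K'}. quotient_complexity \<Sigma> M = m"
    "\<forall>M \<in> {L, L'}. quotient_complexity \<Sigma> M = n"
    "int (quotient_complexity \<Sigma> (K \<inter> L)) = int m * int n - 3 * (int m + int n - 4)"
    "int (quotient_complexity \<Sigma> (K - L)) = int m * int n - (2 * int m + 3 * int n - 9)"
    "int (quotient_complexity \<Sigma> (K' \<union> L')) = int m * int n - (int m + int n)"
    "int (quotient_complexity \<Sigma> (sym_diff K' L')) = int m * int n - (int m + int n)"
proof -
  obtain r t where m: "m = r + 4" and n: "n = t + 4" using assms(3,4) by (metis add.commute le_Suc_ex)
  define K L K' L' where "K = (#) c ` counting_words a b c r" and "L = (#) c ` counting_words b a c t"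
    and "K' = (#) c ` counting_words a b a r" and "L' = (#) c ` counting_words b a b t"
  note defs = K_def L_def K'_def L'_def
  have bac: "distinct [b, a, c]" "{b, a, c} \<subseteq> \<Sigma>" and ne: "\<Sigma> \<noteq> {}" using abc by auto
  have qc: "quotient_complexity \<Sigma> K = m" "quotient_complexity \<Sigma> K' = m"
    "quotient_complexity \<Sigma> L = n" "quotient_complexity \<Sigma> L' = n"
    unfolding defs m n using abc bac by (simp_all only: quotient_complexity_counting_words insertI1 insertI2)
  have ff: "factor_free K" "factor_free L" "factor_free K'" "factor_free L'"
    unfolding defs using abc bac by (simp_all only: factor_free_counting_words insertI1 insertI2)
  have sub: "K \<subseteq> lists \<Sigma>" "L \<subseteq> lists \<Sigma>" "K' \<subseteq> lists \<Sigma>" "L' \<subseteq> lists \<Sigma>"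
    unfolding defs using abc by (intro Cons_counting_words_subset; auto)+
  have reg: "regular_language \<Sigma> K" "regular_language \<Sigma> L" "regular_language \<Sigma> K'" "regular_language \<Sigma> L'"
    using sub qc assms(3,4) by (simp_all add: regular_if_quotient_complexity_pos)
  note up = bifix_free_boolean_bounds[OF factor_free_imp_bifix_free[OF ff(1)] sub(1) qc(1)
      factor_free_imp_bifix_free[OF ff(2)] sub(2) qc(3) ne assms(3,4)]
  note up' = bifix_free_boolean_bounds[OF factor_free_imp_bifix_free[OF ff(3)] sub(3) qc(2)
      factor_free_imp_bifix_free[OF ff(4)] sub(4) qc(4) ne assms(3,4)]
  note lo = intersection_difference_lower_bounds[OF abc, of r t, folded defs]
  note lo' = union_lower_bound[OF abc, of r t, folded defs]
  have "int (quotient_complexity \<Sigma> (K \<inter> L)) = int m * int n - 3 * (int m + int n - 4)"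
    using up(1) of_nat_mono[OF lo(1)[OF up(5)], where 'a = int]
    unfolding m n by (simp add: algebra_simps)
  moreover have "int (quotient_complexity \<Sigma> (K - L)) = int m * int n - (2 * int m + 3 * int n - 9)"
    using up(2) of_nat_mono[OF lo(2)[OF up(6)], where 'a = int]
    unfolding m n by (simp add: algebra_simps)
  moreover have U: "int (quotient_complexity \<Sigma> (K' \<union> L')) = int m * int n - (int m + int n)"
    using up'(3) of_nat_mono[OF lo'[OF up'(7)], where 'a = int]
    unfolding m n by (simp add: algebra_simps)
  moreover have "sym_diff K' L' = K' \<union> L'"
    using disjoint_counting_words[of a b c r t] abc unfolding defs by auto
  then have "int (quotient_complexity \<Sigma> (sym_diff K' L')) = int m * int n - (int m + int n)"
    using U by simp
  ultimately show thesis using that[of K L K' L'] reg ff qc by blast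
qed

theorem theorem1:
  fixes \<Sigma> :: "'a set" and m n :: nat
  assumes "finite \<Sigma>" and "\<Sigma> \<noteq> {}" and "m \<ge> 4" and "n \<ge> 4"
  shows
    "\<forall>free \<in> {bifix_free, factor_free}.
      (\<forall>K L.
        regular_language \<Sigma> K \<and> regular_language \<Sigma> L \<and> free K \<and> free L \<and>
        quotient_complexity \<Sigma> K = m \<and> quotient_complexity \<Sigma> L = n \<longrightarrow>
          int (quotient_complexity \<Sigma> (K \<inter> L)) \<le> int m * int n - 3 * (int m + int n - 4) \<and>
          int (quotient_complexity \<Sigma> (K - L)) \<le> int m * int n - (2 * int m + 3 * int n - 9) \<and>
          int (quotient_complexity \<Sigma> (K \<union> L)) \<le> int m * int n - (int m + int n) \<and>
          int (quotient_complexity \<Sigma> (sym_diff K L)) \<le> int m * int n - (int m + int n)) \<and>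
      (card \<Sigma> \<ge> 3 \<longrightarrow>
        (\<exists>K L.
          regular_language \<Sigma> K \<and> regular_language \<Sigma> L \<and> free K \<and> free L \<and>
          quotient_complexity \<Sigma> K = m \<and> quotient_complexity \<Sigma> L = n \<and>
          int (quotient_complexity \<Sigma> (K \<inter> L)) = int m * int n - 3 * (int m + int n - 4)) \<and>
        (\<exists>K L.
          regular_language \<Sigma> K \<and> regular_language \<Sigma> L \<and> free K \<and> free L \<and>
          quotient_complexity \<Sigma> K = m \<and> quotient_complexity \<Sigma> L = n \<and>
          int (quotient_complexity \<Sigma> (K - L)) = int m * int n - (2 * int m + 3 * int n - 9)) \<and>
        (\<exists>K L.
          regular_language \<Sigma> K \<and> regular_language \<Sigma> L \<and> free K \<and> free L \<and>
          quotient_complexity \<Sigma> K = m \<and> quotient_complexity \<Sigma> L = n \<and>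
          int (quotient_complexity \<Sigma> (K \<union> L)) = int m * int n - (int m + int n)) \<and>
        (\<exists>K L.
          regular_language \<Sigma> K \<and> regular_language \<Sigma> L \<and> free K \<and> free L \<and>
          quotient_complexity \<Sigma> K = m \<and> quotient_complexity \<Sigma> L = n \<and>
          int (quotient_complexity \<Sigma> (sym_diff K L)) = int m * int n - (int m + int n)))"
proof (intro ballI conjI allI impI)
  fix free :: "'a list set \<Rightarrow> bool" and K L :: "'a list set"
  assume free: "free \<in> {bifix_free, factor_free}"
    and KL: "regular_language \<Sigma> K \<and> regular_language \<Sigma> L \<and> free K \<and> free L \<and>
        quotient_complexity \<Sigma> K = m \<and> quotient_complexity \<Sigma> L = n"
  then have K: "bifix_free K" "K \<subseteq> lists \<Sigma>" "quotient_complexity \<Sigma> K = m"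
    and L: "bifix_free L" "L \<subseteq> lists \<Sigma>" "quotient_complexity \<Sigma> L = n"
    using KL factor_free_imp_bifix_free regular_language_subset by blast+
  note bounds = bifix_free_boolean_bounds[OF K L assms(2-4)]
  show "int (quotient_complexity \<Sigma> (K \<inter> L)) \<le> int m * int n - 3 * (int m + int n - 4)"
    by (rule bounds)
  show "int (quotient_complexity \<Sigma> (K - L)) \<le> int m * int n - (2 * int m + 3 * int n - 9)"
    by (rule bounds)
  show "int (quotient_complexity \<Sigma> (K \<union> L)) \<le> int m * int n - (int m + int n)"
    by (rule bounds)
  show "int (quotient_complexity \<Sigma> (sym_diff K L)) \<le> int m * int n - (int m + int n)"
    by (rule bounds)
next
  fix free :: "'a list set \<Rightarrow> bool"
  assume free: "free \<in> {bifix_free, factor_free}" and "card \<Sigma> \<ge> 3"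
  then obtain T where "T \<subseteq> \<Sigma>" "card T = 3" using obtain_subset_with_card_n by metis
  then obtain a b c where abc: "distinct [a, b, c]" "{a, b, c} \<subseteq> \<Sigma>"
    by (auto simp: card_3_iff)
  \<comment> \<open>Factor-free witnesses settle both classes at once.\<close>
  have imp: "free M" if "factor_free M" for M :: "'a list set"
    using that free factor_free_imp_bifix_free by auto
  obtain K L K' L' where w:
    "\<forall>M \<in> {K, L, K', L'}. regular_language \<Sigma> M \<and> factor_free M"
    "\<forall>M \<in> {K, K'}. quotient_complexity \<Sigma> M = m"
    "\<forall>M \<in> {L, L'}. quotient_complexity \<Sigma> M = n"
    "int (quotient_complexity \<Sigma> (K \<inter> L)) = int m * int n - 3 * (int m + int n - 4)"
    "int (quotient_complexity \<Sigma> (K - L)) = int m * int n - (2 * int m + 3 * int n - 9)"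
    "int (quotient_complexity \<Sigma> (K' \<union> L')) = int m * int n - (int m + int n)"
    "int (quotient_complexity \<Sigma> (sym_diff K' L')) = int m * int n - (int m + int n)"
    using factor_free_tight[OF abc assms(3,4)] .
  show "\<exists>K L. regular_language \<Sigma> K \<and> regular_language \<Sigma> L \<and> free K \<and> free L \<and>
      quotient_complexity \<Sigma> K = m \<and> quotient_complexity \<Sigma> L = n \<and>
      int (quotient_complexity \<Sigma> (K \<inter> L)) = int m * int n - 3 * (int m + int n - 4)"
    by (intro exI[of _ K] exI[of _ L] conjI imp w) (simp_all add: w)
  show "\<exists>K L. regular_language \<Sigma> K \<and> regular_language \<Sigma> L \<and> free K \<and> free L \<and>
      quotient_complexity \<Sigma> K = m \<and> quotient_complexity \<Sigma> L = n \<and>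
      int (quotient_complexity \<Sigma> (K - L)) = int m * int n - (2 * int m + 3 * int n - 9)"
    by (intro exI[of _ K] exI[of _ L] conjI imp w) (simp_all add: w)
  show "\<exists>K L. regular_language \<Sigma> K \<and> regular_language \<Sigma> L \<and> free K \<and> free L \<and>
      quotient_complexity \<Sigma> K = m \<and> quotient_complexity \<Sigma> L = n \<and>
      int (quotient_complexity \<Sigma> (K \<union> L)) = int m * int n - (int m + int n)"
    by (intro exI[of _ K'] exI[of _ L'] conjI imp w) (simp_all add: w)
  show "\<exists>K L. regular_language \<Sigma> K \<and> regular_language \<Sigma> L \<and> free K \<and> free L \<and>
      quotient_complexity \<Sigma> K = m \<and> quotient_complexity \<Sigma> L = n \<and>
      int (quotient_complexity \<Sigma> (sym_diff K L)) = int m * int n - (int m + int n)"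
    by (intro exI[of _ K'] exI[of _ L'] conjI imp w) (simp_all add: w)
qed

end
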